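(* Let $d\ge 1$, let $X\subset\mathbb{R}^d$ be a convex set, and let $(\mathcal{X}_n)_{n\in\mathbb{N}}$ be a sequence of discrete subsets of $X$ that is quasi-uniformly distributed in $X$ with constants $c, C>0$, i.e. for every $n$ $$\inf_{\substack{x\neq y\\ x,y\in\mathcal{X}_n}}|x-y|\ \ge\ c\,n^{-1/d}\qquad\text{and}\qquad \sup_{x\in X}\inf_{y\in\mathcal{X}_n}|x-y|\ \le\ C\,n^{-1/d}.$$ Let $\alpha>\frac{d+2}{2}$, let $\kappa>0$, and let $K\in\mathbb{K}_{\kappa,\alpha}$. Then for every $f\in BC(X)$ and every $n\in\mathbb{N}$, $$\left\|\,[S_{K,n}]^{-1}\,\mathcal{T}_n(f)-f\,\right\|_{BC}\ \le\ \kappa\, m_1^{-1}\,(C+1)\,K_d\,C^*_{\alpha,d}\ \omega\!\left(f,n^{-1/d}\right),$$ where $$m_1=\min_{|x|\le 1}K(x),\qquad K_d=2^{\frac{3d+3}{2}}\left(\frac{C}{c}\right)^d,\qquad C^*_{\alpha,d}=\sum_{k=0}^d\binom{d+1}{k}\frac{2\alpha-k+2}{2\alpha-k+1}-\frac{1}{2\alpha-d+1}.$$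
   Context: $|\cdot|$ is the Euclidean norm on $\mathbb{R}^d$. The constants $c,C>0$ are independent of $n$ (and satisfy $C\ge c/2$). For $\alpha>0$ and $\kappa>0$, $\mathbb{K}_{\kappa,\alpha}$ is the class of functions $K$ such that: (i) $K:\mathbb{R}^d\to\mathbb{R}_+$ is continuous, where $\mathbb{R}_+$ denotes the nonnegative reals; (ii) $m_1:=\min_{|x|\le1}K(x)>0$; (iii) $K(x)\le\kappa(1+|x|^2)^{-\alpha}$ for all $x\in\mathbb{R}^d$. $BC(X)$ is the normed space of bounded continuous real functions on $X$ with norm $\|f\|_{BC}=\inf\{M: |f(x)|\le M \text{ for all } x\in X\}$ (the sup norm). Put $\beta_n:=C^{-1}n^{1/d}$ and $K_n(x):=K(\beta_n x)$. For $x\in X$ define $$\mathcal{T}_n(f)(x)=\sum_{y\in\mathcal{X}_n}f(y)K_n(x-y),\qquad S_{K,n}(x)=\sum_{y\in\mathcal{X}_n}K_n(x-y),$$ and $[S_{K,n}]^{-1}$ denotes the pointwise reciprocal $x\mapsto 1/S_{K,n}(x)$. The modulus of continuity of $f$ is $\omega(f,t)=\sup\{|f(x)-f(y)|: x,y\in X,\ |x-y|\le t\}$, $t\ge0$. *)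

theory Defs
  imports "HOL-Analysis.Analysis"
begin

text \<open>
  The Euclidean space $R^d$ is \<^typ>\<open>real ^ 'd\<close>, with $d$ = \<^term>\<open>CARD('d)\<close>;
  \<^const>\<open>norm\<close> is the Euclidean norm on this type.
\<close>

text \<open>
  The infimum and supremum are taken in \<^typ>\<open>ereal\<close>, so that an infimum over an empty
  index set is infinite: separation is vacuous for a set with at most one point, and
  an empty \<^term>\<open>\<X> n\<close> does not satisfy the covering condition for nonempty \<^term>\<open>X\<close>.
  The index \<^term>\<open>n\<close> starts at 1.
\<close>

definition quasi_uniformly_distributed ::
  "(real ^ 'd) set \<Rightarrow> (nat \<Rightarrow> (real ^ 'd) set) \<Rightarrow> real \<Rightarrow> real \<Rightarrow> bool" where
  "quasi_uniformly_distributed X \<X> c C \<longleftrightarrow>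
     (\<forall>n\<ge>1.
        (INF (x, y) \<in> {(x, y). x \<in> \<X> n \<and> y \<in> \<X> n \<and> x \<noteq> y}. ereal (norm (x - y)))
          \<ge> ereal (c * real n powr (- 1 / real CARD('d))) \<and>
        (SUP x \<in> X. INF y \<in> \<X> n. ereal (norm (x - y)))
          \<le> ereal (C * real n powr (- 1 / real CARD('d))))"

text \<open>For continuous \<^term>\<open>K\<close> the infimum is attained, as \<^term>\<open>cball 0 1\<close> is compact.\<close>

definition kernel_min :: "(real ^ 'd \<Rightarrow> real) \<Rightarrow> real" where
  "kernel_min K = (INF x \<in> cball 0 1. K x)"

definition kernel_class :: "real \<Rightarrow> real \<Rightarrow> (real ^ 'd \<Rightarrow> real) set" where
  "kernel_class \<kappa> \<alpha> =
     {K. continuous_on UNIV K \<and> (\<forall>x. 0 \<le> K x) \<and> kernel_min K > 0 \<and>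
         (\<forall>x. K x \<le> \<kappa> * (1 + (norm x)\<^sup>2) powr (- \<alpha>))}"

definition BC :: "'a::topological_space set \<Rightarrow> ('a \<Rightarrow> real) set" where
  "BC X = {f. continuous_on X f \<and> bounded (f ` X)}"

text \<open>Only meaningful for nonempty \<^term>\<open>X\<close> and functions in \<^term>\<open>BC X\<close>.\<close>

definition bc_norm :: "'a::topological_space set \<Rightarrow> ('a \<Rightarrow> real) \<Rightarrow> real" where
  "bc_norm X f = Inf {M. \<forall>x\<in>X. \<bar>f x\<bar> \<le> M}"

definition modulus :: "(real ^ 'd) set \<Rightarrow> (real ^ 'd \<Rightarrow> real) \<Rightarrow> real \<Rightarrow> real" where
  "modulus X f t = Sup {\<bar>f x - f y\<bar> |x y. x \<in> X \<and> y \<in> X \<and> norm (x - y) \<le> t}"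

definition scaled_kernel :: "real \<Rightarrow> (real ^ 'd \<Rightarrow> real) \<Rightarrow> nat \<Rightarrow> real ^ 'd \<Rightarrow> real" where
  "scaled_kernel C K n x = K ((inverse C * real n powr (1 / real CARD('d))) *\<^sub>R x)"

text \<open>
  The sets \<^term>\<open>\<X> n\<close> may be infinite, hence unordered infinite sums. They converge
  absolutely for separated \<^term>\<open>\<X> n\<close>, \<^term>\<open>K \<in> kernel_class \<kappa> \<alpha>\<close> with
  $2 \alpha > d$ and bounded \<^term>\<open>f\<close>.
\<close>

definition kernel_operator ::
  "(nat \<Rightarrow> (real ^ 'd) set) \<Rightarrow> real \<Rightarrow> (real ^ 'd \<Rightarrow> real) \<Rightarrow> nat \<Rightarrow>
    (real ^ 'd \<Rightarrow> real) \<Rightarrow> real ^ 'd \<Rightarrow> real" where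
  "kernel_operator \<X> C K n f x = (\<Sum>\<^sub>\<infinity>y\<in>\<X> n. f y * scaled_kernel C K n (x - y))"

definition kernel_sum ::
  "(nat \<Rightarrow> (real ^ 'd) set) \<Rightarrow> real \<Rightarrow> (real ^ 'd \<Rightarrow> real) \<Rightarrow> nat \<Rightarrow> real ^ 'd \<Rightarrow> real" where
  "kernel_sum \<X> C K n x = (\<Sum>\<^sub>\<infinity>y\<in>\<X> n. scaled_kernel C K n (x - y))"

definition dim_const :: "nat \<Rightarrow> real \<Rightarrow> real \<Rightarrow> real" where
  "dim_const d c C = 2 powr ((3 * real d + 3) / 2) * (C / c) ^ d"

definition decay_const :: "real \<Rightarrow> nat \<Rightarrow> real" where
  "decay_const \<alpha> d =
     (\<Sum>k=0..d. real ((d + 1) choose k) * ((2 * \<alpha> - real k + 2) / (2 * \<alpha> - real k + 1)))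
       - 1 / (2 * \<alpha> - real d + 1)"

end

theory Submission
  imports Defs
begin

text \<open>
  Write $h = n^{-1/d}$ and $u_y = |x - y| / (C h)$. Covering gives a node with $u_y \le 1$, hence
  $S_{K,n} \ge m_1$. Convexity of $X$ gives
  $|f(y) - f(x)| \le (1 + |x - y|/h)\, \omega(f,h) = (1 + C u_y)\, \omega(f,h)$, and since
  $2\alpha > d + 2$ the product $(1 + C u_y) K_n(x - y)$ is at most a constant times
  $(1 + u_y)^{-(d+1)}$. By separation and comparison of ball volumes at most $(2 C s / c)^d$
  nodes satisfy $1 + u_y < s$, so a dyadic decomposition bounds the sum of these weights by
  $2^{d+1} (2C/c)^d$. The resulting constant fits because $C^*_{\alpha,d} \ge 2^d$. Continuity of the
  two series follows from the Weierstrass M-test with the same weights.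
\<close>

section \<open>Packing and weighted sums over separated sets\<close>

text \<open>Volume comparison: the balls of radius \<open>\<delta>/2\<close> about the points are
  disjoint and all lie in \<open>ball x (r + \<delta>/2)\<close>.\<close>

lemma card_separated_le:
  fixes x :: "'a::euclidean_space"
  assumes "finite F" and "\<delta> > 0" and "r \<ge> 0"
    and sep: "\<And>y z. y \<in> F \<Longrightarrow> z \<in> F \<Longrightarrow> y \<noteq> z \<Longrightarrow> \<delta> \<le> dist y z"
    and near: "\<And>y. y \<in> F \<Longrightarrow> dist x y \<le> r"
  shows "real (card F) \<le> (2 * r / \<delta> + 1) ^ DIM('a)"
proof -
  let ?V = "measure lebesgue (ball (0::'a) 1)"
  have "disjnt (ball y (\<delta>/2)) (ball z (\<delta>/2))" if "y \<in> F" "z \<in> F" "y \<noteq> z" for y z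
    using sep[OF that] unfolding disjnt_iff by (smt (verit, best) dist_commute dist_triangle mem_ball field_sum_of_halves)
  then have "(\<Sum>y\<in>F. measure lebesgue (ball y (\<delta>/2))) = measure lebesgue (\<Union>y\<in>F. ball y (\<delta>/2))"
    by (intro measure_UNION'[symmetric]) (auto simp: assms pairwise_def)
  also have "\<dots> \<le> measure lebesgue (ball x (r + \<delta>/2))"
  proof (rule measure_mono_fmeasurable)
    show "(\<Union>y\<in>F. ball y (\<delta>/2)) \<subseteq> ball x (r + \<delta>/2)"
    proof clarify
      fix y z assume "y \<in> F" "z \<in> ball y (\<delta>/2)"
      with near[of y] dist_triangle[of x z y] show "z \<in> ball x (r + \<delta>/2)" by simp
    qed
  qed (auto intro!: sets.finite_UN assms)
  finally have "real (card F) * ((\<delta>/2) ^ DIM('a) * ?V) \<le> (r + \<delta>/2) ^ DIM('a) * ?V"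
    using assms by (simp add: content_ball_conv_unit_ball[of "\<delta>/2"] content_ball_conv_unit_ball[of "r + \<delta>/2"])
  moreover have "?V > 0" by (simp add: content_ball_pos)
  ultimately have "real (card F) * (\<delta>/2) ^ DIM('a) \<le> (r + \<delta>/2) ^ DIM('a)"
    by (simp flip: mult.assoc)
  also have "r + \<delta>/2 = (2 * r / \<delta> + 1) * (\<delta>/2)"
    using \<open>\<delta> > 0\<close> by (simp add: field_simps)
  finally show ?thesis
    unfolding power_mult_distrib by (rule mult_right_le_imp_le) (use \<open>\<delta> > 0\<close> in simp)
qed

text \<open>Dyadic decomposition: the shell \<open>2^j \<le> 1 + b * dist x y < 2^(j+1)\<close> contributes at most
  \<open>(4 / (b * \<delta>))^d * (1/2)^j\<close>.\<close>

lemma sum_separated_le: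
  fixes x :: "'a::euclidean_space"
  assumes "finite F" and "\<delta> > 0" and "b > 0" and "b * \<delta> \<le> 2"
    and sep: "\<And>y z. y \<in> F \<Longrightarrow> z \<in> F \<Longrightarrow> y \<noteq> z \<Longrightarrow> \<delta> \<le> dist y z"
  shows "(\<Sum>y\<in>F. inverse ((1 + b * dist x y) ^ (DIM('a) + 1)))
           \<le> 2 ^ (DIM('a) + 1) * (2 / (b * \<delta>)) ^ DIM('a)"
proof -
  let ?d = "DIM('a)" and ?u = "\<lambda>y. 1 + b * dist x y" and ?A = "2 / (b * \<delta>)"
  let ?w = "\<lambda>y. inverse (?u y ^ (?d + 1))"
  have A: "?A \<ge> 1" using assms by simp
  have u: "?u y \<ge> 1" for y using assms by simp
  have card: "real (card {y \<in> F. ?u y < s}) \<le> (?A * s) ^ ?d" if "s \<ge> 1" for s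
  proof -
    have "real (card {y \<in> F. ?u y < s}) \<le> (2 * ((s - 1) / b) / \<delta> + 1) ^ ?d"
      using assms that by (intro card_separated_le[of _ _ _ x]) (auto simp: field_simps)
    also have "2 * ((s - 1) / b) / \<delta> + 1 = ?A * s - (?A - 1)"
      using assms by (simp add: field_simps)
    also have "\<dots> ^ ?d \<le> (?A * s) ^ ?d"
    proof (rule power_mono)
      have "?A * 1 \<le> ?A * s" using that assms by (intro mult_left_mono) auto
      then show "0 \<le> ?A * s - (?A - 1)" by simp
    qed (use A in linarith)
    finally show ?thesis .
  qed
  \<comment> \<open>\<open>2 - 2 * (1/2) ^ J\<close> is the sum of \<open>(1/2) ^ j\<close> over
    \<open>j < J\<close>. It vanishes at \<open>J = 0\<close>, where the index set is empty because
    \<open>?u y \<ge> 1\<close>.\<close>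
  have bound: "(\<Sum>y | y \<in> F \<and> ?u y < 2 ^ J. ?w y) \<le> (2 * ?A) ^ ?d * (2 - 2 * (1/2) ^ J)" for J
  proof (induction J)
    case 0
    have "{y \<in> F. ?u y < 2 ^ 0} = {}" using u by (auto simp: not_less)
    then show ?case by (simp only: sum.empty) simp
  next
    case (Suc J)
    have split: "{y \<in> F. ?u y < 2 ^ Suc J}
        = {y \<in> F. ?u y < 2 ^ J} \<union> {y \<in> F. 2 ^ J \<le> ?u y \<and> ?u y < 2 ^ Suc J}" (is "_ = ?L \<union> ?R")
      by (auto intro: less_le_trans[of _ "2 ^ J"])
    have "(\<Sum>y\<in>?R. ?w y) \<le> (\<Sum>y\<in>?R. inverse ((2 ^ J) ^ (?d + 1)))"
      by (intro sum_mono le_imp_inverse_le power_mono zero_less_power) auto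
    also have "\<dots> = real (card ?R) * inverse ((2 ^ J) ^ (?d + 1))" by simp
    \<comment> \<open>The count grows with the power \<open>?d\<close> of \<open>2 ^ J\<close>, the
      weight decays with the power \<open>?d + 1\<close>; this surplus power makes the shells
      geometrically summable.\<close>
    also have "\<dots> \<le> (?A * 2 ^ Suc J) ^ ?d * inverse ((2 ^ J) ^ (?d + 1))"
    proof (rule mult_right_mono)
      have "real (card ?R) \<le> real (card {y \<in> F. ?u y < 2 ^ Suc J})"
        using \<open>finite F\<close> by (intro of_nat_mono card_mono) auto
      also have "\<dots> \<le> (?A * 2 ^ Suc J) ^ ?d"
        by (rule card) (rule one_le_power, simp)
      finally show "real (card ?R) \<le> (?A * 2 ^ Suc J) ^ ?d" .
    qed simp
    also have "\<dots> = (2 * ?A) ^ ?d * (1/2) ^ J"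
      by (simp add: power_mult_distrib power_divide field_simps)
    finally have "(\<Sum>y\<in>?R. ?w y) \<le> (2 * ?A) ^ ?d * (1/2) ^ J" .
    moreover have "(\<Sum>y\<in>?L \<union> ?R. ?w y) = (\<Sum>y\<in>?L. ?w y) + (\<Sum>y\<in>?R. ?w y)"
      using \<open>finite F\<close> by (intro sum.union_disjoint) auto
    ultimately show ?case
      using Suc.IH unfolding split by (simp add: algebra_simps)
  qed
  \<comment> \<open>Finitely many shells exhaust \<open>F\<close>.\<close>
  obtain M where M: "\<And>y. y \<in> F \<Longrightarrow> ?u y \<le> M"
    using \<open>finite F\<close> by (metis Max_ge finite_imageI imageI)
  obtain J where "M < 2 ^ J" using real_arch_pow[of 2 M] by auto
  with M have "{y \<in> F. ?u y < 2 ^ J} = F" by (auto intro: le_less_trans)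
  with bound[of J] have "(\<Sum>y\<in>F. ?w y) \<le> (2 * ?A) ^ ?d * (2 - 2 * (1/2) ^ J)" by simp
  also have "\<dots> \<le> (2 * ?A) ^ ?d * 2"
    using assms by (intro mult_left_mono zero_le_power) auto
  also have "\<dots> = 2 ^ (?d + 1) * ?A ^ ?d"
    unfolding power_mult_distrib[of 2] by simp
  finally show ?thesis .
qed

text \<open>The bound for finite subsets is uniform and the terms are nonnegative, so it yields
  summability and passes to the infinite sum.\<close>

lemma
  fixes x :: "'a::euclidean_space"
  assumes "\<delta> > 0" and "b > 0" and "b * \<delta> \<le> 2"
    and sep: "\<And>y z. y \<in> P \<Longrightarrow> z \<in> P \<Longrightarrow> y \<noteq> z \<Longrightarrow> \<delta> \<le> dist y z"
  shows summable_on_separated: "(\<lambda>y. inverse ((1 + b * dist x y) ^ (DIM('a) + 1))) summable_on P"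
    and infsum_separated_le: "(\<Sum>\<^sub>\<infinity>y\<in>P. inverse ((1 + b * dist x y) ^ (DIM('a) + 1)))
           \<le> 2 ^ (DIM('a) + 1) * (2 / (b * \<delta>)) ^ DIM('a)"
proof -
  have fin: "(\<Sum>y\<in>F. inverse ((1 + b * dist x y) ^ (DIM('a) + 1)))
           \<le> 2 ^ (DIM('a) + 1) * (2 / (b * \<delta>)) ^ DIM('a)" if "finite F" "F \<subseteq> P" for F
    by (rule sum_separated_le[OF that(1) assms(1-3)]) (use that(2) sep in blast)
  show "(\<lambda>y. inverse ((1 + b * dist x y) ^ (DIM('a) + 1))) summable_on P"
  proof (rule nonneg_bdd_above_summable_on)
    show "bdd_above (sum (\<lambda>y. inverse ((1 + b * dist x y) ^ (DIM('a) + 1))) ` {F. F \<subseteq> P \<and> finite F})"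
      using fin by (intro bdd_aboveI2) auto
  qed (use \<open>b > 0\<close> in simp)
  then show "(\<Sum>\<^sub>\<infinity>y\<in>P. inverse ((1 + b * dist x y) ^ (DIM('a) + 1)))
           \<le> 2 ^ (DIM('a) + 1) * (2 / (b * \<delta>)) ^ DIM('a)"
    by (rule infsum_le_finite_sums) (rule fin)
qed

text \<open>Continuity is local, so the M-test is applied on each ball of radius
  \<open>1 / b\<close>, with a majorant that depends only on the centre \<open>z\<close>.\<close>

lemma continuous_on_infsum_separated:
  fixes K f :: "'a::euclidean_space \<Rightarrow> real"
  assumes "\<delta> > 0" and "b > 0" and "b * \<delta> \<le> 2"
    and sep: "\<And>y z. y \<in> P \<Longrightarrow> z \<in> P \<Longrightarrow> y \<noteq> z \<Longrightarrow> \<delta> \<le> dist y z"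
    and cont: "continuous_on UNIV K"
    and K: "\<And>v. \<bar>K v\<bar> \<le> A * inverse ((1 + norm v) ^ (DIM('a) + 1))"
    and f: "\<And>y. y \<in> P \<Longrightarrow> \<bar>f y\<bar> \<le> B"
  shows "continuous_on UNIV (\<lambda>x. \<Sum>\<^sub>\<infinity>y\<in>P. f y * K (b *\<^sub>R (x - y)))"
proof -
  let ?g = "\<lambda>x. \<Sum>\<^sub>\<infinity>y\<in>P. f y * K (b *\<^sub>R (x - y))" and ?e = "DIM('a) + 1"
  have "isCont ?g z" for z
  proof -
    have "A \<ge> 0" using K[of 0] by simp
    have dom: "norm (f y * K (b *\<^sub>R (x - y))) \<le> B * A * 2 ^ ?e * inverse ((1 + b * dist z y) ^ ?e)"
      if "y \<in> P" "x \<in> ball z (1 / b)" for x y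
    proof -
      have "b * dist z y \<le> b * dist z x + b * dist x y"
        using \<open>b > 0\<close> by (simp flip: distrib_left add: dist_triangle)
      also have "b * dist z x \<le> 1"
        using that \<open>b > 0\<close> by (simp add: field_simps)
      finally have "b * dist z y \<le> 1 + b * dist x y" by simp
      moreover have "0 \<le> b * dist x y" using \<open>b > 0\<close> by simp
      \<comment> \<open>Moving the base point from \<open>z\<close> to \<open>x\<close> costs at
        most a factor 2 per power, hence \<open>2 ^ ?e\<close> in the majorant.\<close>
      ultimately have "(1 + b * dist z y) / 2 \<le> 1 + b * dist x y" by simp
      moreover have pos: "(1 + b * dist z y) / 2 > 0"
        using \<open>b > 0\<close> by (simp add: add_pos_nonneg)
      ultimately have "inverse ((1 + b * dist x y) ^ ?e) \<le> inverse (((1 + b * dist z y) / 2) ^ ?e)"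
        by (intro le_imp_inverse_le power_mono zero_less_power) auto
      also have "\<dots> = 2 ^ ?e * inverse ((1 + b * dist z y) ^ ?e)"
        by (simp only: power_divide inverse_divide) (simp only: divide_inverse)
      finally have "\<bar>K (b *\<^sub>R (x - y))\<bar> \<le> A * (2 ^ ?e * inverse ((1 + b * dist z y) ^ ?e))"
        using K[of "b *\<^sub>R (x - y)"] \<open>A \<ge> 0\<close> \<open>b > 0\<close>
        by (simp add: dist_norm del: power_Suc) (meson mult_left_mono order_trans)
      then have "\<bar>f y\<bar> * \<bar>K (b *\<^sub>R (x - y))\<bar> \<le> B * (A * (2 ^ ?e * inverse ((1 + b * dist z y) ^ ?e)))"
        using f[OF that(1)] by (intro mult_mono) auto
      then show ?thesis by (simp add: abs_mult mult.assoc)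
    qed
    have "(\<lambda>y. B * A * 2 ^ ?e * inverse ((1 + b * dist z y) ^ ?e)) summable_on P"
      by (intro summable_on_cmult_right summable_on_separated[OF assms(1-3)] sep)
    from Weierstrass_m_test_general[OF dom this]
    have "uniform_limit (ball z (1 / b)) (\<lambda>Y x. \<Sum>y\<in>Y. f y * K (b *\<^sub>R (x - y))) ?g
           (finite_subsets_at_top P)" .
    then have "continuous_on (ball z (1 / b)) ?g"
      by (rule uniform_limit_theorem[rotated])
        (auto intro!: always_eventually continuous_intros continuous_on_compose2[OF cont])
    then show ?thesis
      using \<open>b > 0\<close> by (simp add: continuous_on_eq_continuous_at)
  qed
  then show ?thesis by (simp add: continuous_on_eq_continuous_at)
qed

section \<open>The modulus of continuity on a convex set\<close>

text \<open>Boundedness of \<open>f\<close> bounds the set of differences above, which a real-valued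
  \<open>Sup\<close> requires in order to be an upper bound.\<close>

lemma BC_abs_diff_le_modulus:
  assumes "f \<in> BC X" and "x \<in> X" and "y \<in> X" and "dist x y \<le> t"
  shows "\<bar>f x - f y\<bar> \<le> modulus X f t"
proof -
  obtain B where B: "\<And>x. x \<in> X \<Longrightarrow> \<bar>f x\<bar> \<le> B"
    using assms(1) unfolding BC_def bounded_iff by auto
  have "bdd_above {\<bar>f x - f y\<bar> |x y. x \<in> X \<and> y \<in> X \<and> norm (x - y) \<le> t}"
  proof (rule bdd_aboveI)
    fix v assume "v \<in> {\<bar>f x - f y\<bar> |x y. x \<in> X \<and> y \<in> X \<and> norm (x - y) \<le> t}"
    then obtain x y where "v = \<bar>f x - f y\<bar>" "x \<in> X" "y \<in> X" by blast
    then show "v \<le> 2 * B" using B[of x] B[of y] by linarith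
  qed
  then show ?thesis
    unfolding modulus_def using assms(2-) by (intro cSup_upper) (auto simp: dist_norm)
qed

text \<open>The segment from \<open>x\<close> to \<open>y\<close> is cut into \<open>N\<close>
  pieces of length at most \<open>t\<close>; convexity keeps the division points in
  \<open>X\<close>. For \<open>N = 0\<close> the points coincide.\<close>

lemma abs_diff_le_mult_modulus:
  assumes "convex X" and "f \<in> BC X" and "x \<in> X" and "y \<in> X" and "dist x y \<le> real N * t"
  shows "\<bar>f x - f y\<bar> \<le> real N * modulus X f t"
  using assms(3-)
proof (induction N arbitrary: x)
  case 0
  then show ?case by simp
next
  case (Suc N)
  \<comment> \<open>The first of \<open>Suc N\<close> equal pieces is split off: \<open>z\<close>
    lies within \<open>t\<close> of \<open>x\<close>, and a distance of at most \<open>N * t\<close>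
    remains for the induction hypothesis.\<close>
  define s where "s = 1 / real (Suc N)"
  have s: "0 < s" "s \<le> 1" and Ns: "(1 - s) * real (Suc N) = real N"
    unfolding s_def by (simp_all add: field_simps)
  define z where "z = (1 - s) *\<^sub>R x + s *\<^sub>R y"
  have "z \<in> X" unfolding z_def using assms(1) Suc.prems s by (intro convexD) auto
  have "x - z = s *\<^sub>R (x - y)" and "z - y = (1 - s) *\<^sub>R (x - y)"
    unfolding z_def by (simp_all add: algebra_simps)
  then have xz: "dist x z = s * dist x y" and zy: "dist z y = (1 - s) * dist x y"
    using s by (simp_all add: dist_norm)
  have "dist x z \<le> s * (real (Suc N) * t)"
    unfolding xz using Suc.prems s by (intro mult_left_mono) auto
  then have "dist x z \<le> t" by (simp add: s_def)
  have "dist z y \<le> (1 - s) * (real (Suc N) * t)"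
    unfolding zy using Suc.prems s by (intro mult_left_mono) auto
  then have "dist z y \<le> real N * t" by (metis Ns mult.assoc)
  then have "\<bar>f z - f y\<bar> \<le> real N * modulus X f t"
    using Suc.IH \<open>z \<in> X\<close> Suc.prems by blast
  moreover have "\<bar>f x - f z\<bar> \<le> modulus X f t"
    using BC_abs_diff_le_modulus[OF assms(2)] Suc.prems \<open>z \<in> X\<close> \<open>dist x z \<le> t\<close> by blast
  ultimately show ?case by (simp add: algebra_simps)
qed

text \<open>Rounding \<open>dist x y / t\<close> up to an integer number of pieces costs the
  additive 1.\<close>

lemma abs_diff_le_modulus:
  assumes "convex X" and "f \<in> BC X" and "x \<in> X" and "y \<in> X" and "t > 0"
  shows "\<bar>f x - f y\<bar> \<le> (1 + dist x y / t) * modulus X f t"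
proof -
  define N where "N = nat \<lceil>dist x y / t\<rceil>"
  have N: "dist x y / t \<le> real N" "real N \<le> 1 + dist x y / t"
    using \<open>t > 0\<close> unfolding N_def by (auto simp: of_nat_nat intro: order_trans[OF of_int_ceiling_le_add_one])
  have "modulus X f t \<ge> 0"
    using BC_abs_diff_le_modulus[of f X x x t] assms by simp
  moreover have "\<bar>f x - f y\<bar> \<le> real N * modulus X f t"
    by (rule abs_diff_le_mult_modulus) (use assms N in \<open>auto simp: field_simps\<close>)
  ultimately show ?thesis
    using N(2) by (meson mult_right_mono order_trans)
qed

section \<open>Decay of the kernel and size of the constant\<close>

text \<open>The factor \<open>1 + C * norm v\<close> is the growth allowed by the modulus
  inequality. It costs a power 1/2 of \<open>1 + (norm v)\<^sup>2\<close>, and the hypothesis on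
  \<open>\<alpha>\<close> leaves exponent below \<open>-(d + 1) / 2\<close>, as the weighted sums
  need.\<close>

lemma kernel_class_decay:
  fixes K :: "real ^ 'd \<Rightarrow> real"
  assumes "K \<in> kernel_class \<kappa> \<alpha>" and "\<kappa> > 0" and "C > 0" and \<alpha>: "\<alpha> > (real CARD('d) + 2) / 2"
  shows "(1 + C * norm v) * K v
    \<le> (C + 1) * \<kappa> * 2 powr ((real CARD('d) + 1) / 2) * inverse ((1 + norm v) ^ (CARD('d) + 1))"
proof -
  let ?q = "1 + (norm v)\<^sup>2" and ?p = "(real CARD('d) + 1) / 2"
  have q: "?q \<ge> 1" by simp
  have K: "0 \<le> K v" "K v \<le> \<kappa> * ?q powr (- \<alpha>)"
    using assms(1) by (auto simp: kernel_class_def)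
  have sq: "1 \<le> sqrt ?q" "norm v \<le> sqrt ?q" by (auto intro: real_le_rsqrt)
  have "1 + C * norm v \<le> sqrt ?q + C * sqrt ?q"
    using sq \<open>C > 0\<close> by (intro add_mono mult_left_mono) auto
  also have "\<dots> = (C + 1) * ?q powr (1/2)"
    using q by (simp add: powr_half_sqrt algebra_simps)
  finally have "(1 + C * norm v) * K v \<le> ((C + 1) * ?q powr (1/2)) * (\<kappa> * ?q powr (- \<alpha>))"
    using K \<open>C > 0\<close> by (intro mult_mono) auto
  also have "\<dots> = (C + 1) * \<kappa> * ?q powr (1/2 - \<alpha>)"
    unfolding diff_conv_add_uminus powr_add by (simp only: mult_ac)
  also have "\<dots> \<le> (C + 1) * \<kappa> * (2 powr ?p * inverse ((1 + norm v) ^ (CARD('d) + 1)))"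
  proof (intro mult_left_mono)
    have pos: "1 + norm v > 0" by (simp add: add_pos_nonneg)
    have "2 * ?p = real (CARD('d) + 1)" by simp
    then have "(1 + norm v) ^ (CARD('d) + 1) = (1 + norm v) powr (2 * ?p)"
      by (simp only: powr_realpow[OF pos])
    also have "\<dots> = ((1 + norm v)\<^sup>2) powr ?p"
      unfolding powr_powr[symmetric] using pos by simp
    \<comment> \<open>\<open>(1 + r)^2 \<le> 2 * (1 + r^2)\<close>, the source of the factor
      \<open>2 powr ?p\<close>.\<close>
    also have "\<dots> \<le> (2 * ?q) powr ?p"
      using sum_squares_bound[of 1 "norm v"] by (intro powr_mono2) (auto simp: power2_sum)
    also have "\<dots> = 2 powr ?p * ?q powr ?p"
      by (rule powr_mult)
    finally have le: "(1 + norm v) ^ (CARD('d) + 1) \<le> 2 powr ?p * ?q powr ?p" .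
    have "inverse g \<le> t * inverse a" if "a \<le> t * g" "0 < a" "0 < g" for a g t :: real
      using that by (simp add: field_simps)
    from this[OF le] have "?q powr (- ?p) \<le> 2 powr ?p * inverse ((1 + norm v) ^ (CARD('d) + 1))"
      unfolding powr_minus using q pos by simp
    moreover have "?q powr (1/2 - \<alpha>) \<le> ?q powr (- ?p)"
      using q \<alpha> by (intro powr_mono) (auto simp: field_simps)
    ultimately show "?q powr (1/2 - \<alpha>) \<le> 2 powr ?p * inverse ((1 + norm v) ^ (CARD('d) + 1))"
      by linarith
  qed (use assms in auto)
  finally show ?thesis by (simp add: mult.assoc)
qed

text \<open>Each fraction is 1 plus a positive reciprocal. The ones contribute
  \<open>2 ^ (d + 1) - 1\<close>, the binomial row without its last entry, and the reciprocal at
  \<open>k = d\<close> pays for the subtracted term.\<close>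

lemma decay_const_ge:
  assumes "2 * \<alpha> > real d"
  shows "2 ^ d \<le> decay_const \<alpha> d"
proof -
  let ?t = "\<lambda>k. real ((d + 1) choose k) / (2 * \<alpha> - real k + 1)"
  have "real ((d + 1) choose k) * ((2 * \<alpha> - real k + 2) / (2 * \<alpha> - real k + 1))
      = real ((d + 1) choose k) + ?t k" if "k \<in> {0..d}" for k
    using assms that by (simp add: field_simps)
  then have eq: "decay_const \<alpha> d
      = (\<Sum>k=0..d. real ((d + 1) choose k)) + (\<Sum>k=0..d. ?t k) - 1 / (2 * \<alpha> - real d + 1)"
    unfolding decay_const_def by (simp add: sum.distrib)
  have "(\<Sum>k=0..d. real ((d + 1) choose k)) + 1 = (\<Sum>k\<le>d + 1. real ((d + 1) choose k))"
    by (simp add: atLeast0AtMost)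
  also have "\<dots> = real (2 ^ (d + 1))"
    using choose_row_sum[of "d + 1"] by (metis of_nat_sum)
  finally have binom: "(\<Sum>k=0..d. real ((d + 1) choose k)) = 2 ^ (d + 1) - 1" by simp
  have "1 / (2 * \<alpha> - real d + 1) \<le> ?t d"
    using assms by (intro divide_right_mono) auto
  also have "\<dots> \<le> (\<Sum>k=0..d. ?t k)"
    using assms by (intro member_le_sum) (auto intro!: divide_nonneg_nonneg)
  finally have "2 * 2 ^ d - 1 \<le> decay_const \<alpha> d"
    unfolding eq binom by simp
  moreover have "(1::real) \<le> 2 ^ d" by simp
  ultimately show ?thesis by linarith
qed

section \<open>Pointwise consequences of quasi-uniform distribution\<close>

lemma quasi_uniformly_distributed_separated:
  assumes "quasi_uniformly_distributed X \<X> c C" and "n \<ge> 1"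
    and "y \<in> \<X> n" and "z \<in> \<X> n" and "y \<noteq> z"
  shows "c * real n powr (- 1 / real CARD('d)) \<le> dist y (z :: real ^ 'd)"
proof -
  have "ereal (c * real n powr (- 1 / real CARD('d)))
      \<le> (INF (x, y) \<in> {(x, y). x \<in> \<X> n \<and> y \<in> \<X> n \<and> x \<noteq> y}. ereal (norm (x - y)))"
    using assms(1,2) unfolding quasi_uniformly_distributed_def by blast
  also have "\<dots> \<le> ereal (norm (y - z))"
    by (rule INF_lower2[of "(y, z)"]) (use assms in auto)
  finally show ?thesis by (simp add: dist_norm)
qed

text \<open>The covering condition bounds only an infimum. Separation makes the node set closed, so
  the distance to it is attained and the non-strict bound holds at an actual node.\<close>

lemma quasi_uniformly_distributed_covering:
  fixes X :: "(real ^ 'd) set"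
  assumes "quasi_uniformly_distributed X \<X> c C" and "n \<ge> 1" and "c > 0" and "x \<in> X"
  obtains y where "y \<in> \<X> n" and "dist x y \<le> C * real n powr (- 1 / real CARD('d))"
proof -
  let ?h = "real n powr (- 1 / real CARD('d))"
  have "(INF y \<in> \<X> n. ereal (norm (x - y))) \<le> (SUP x \<in> X. INF y \<in> \<X> n. ereal (norm (x - y)))"
    using \<open>x \<in> X\<close> by (rule SUP_upper)
  also have "\<dots> \<le> ereal (C * ?h)"
    using assms(1,2) unfolding quasi_uniformly_distributed_def by blast
  finally have inf: "(INF y \<in> \<X> n. ereal (norm (x - y))) \<le> ereal (C * ?h)" .
  have closed: "closed (\<X> n)"
  proof (rule discrete_imp_closed[of "c * ?h"])
    show "\<forall>y\<in>\<X> n. \<forall>z\<in>\<X> n. dist z y < c * ?h \<longrightarrow> z = y"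
      using quasi_uniformly_distributed_separated[OF assms(1,2)] by (meson not_le)
  qed (use assms in simp)
  \<comment> \<open>Over an empty node set the \<open>ereal\<close> infimum would be
    infinite.\<close>
  have ne: "\<X> n \<noteq> {}" using inf by (auto simp: top_ereal_def)
  obtain y where y: "y \<in> \<X> n" "infdist x (\<X> n) = dist x y"
    using infdist_attains_inf[OF closed ne] by blast
  have "ereal (dist x y) \<le> (INF z \<in> \<X> n. ereal (norm (x - z)))"
    using infdist_le[of _ "\<X> n" x] by (auto intro!: INF_greatest simp flip: y(2) dist_norm)
  with inf have "ereal (dist x y) \<le> ereal (C * ?h)" by (rule order_trans[rotated])
  then show thesis using y that by simp
qed

section \<open>Error estimate for the normalised kernel operator\<close>

theorem theorem3p3:
  fixes X :: "(real ^ 'd) set"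
    and \<X> :: "nat \<Rightarrow> (real ^ 'd) set"
    and K f :: "real ^ 'd \<Rightarrow> real"
    and c C \<alpha> \<kappa> :: real
    and n :: nat
  assumes "convex X" and "X \<noteq> {}"
    and "\<And>m. m \<ge> 1 \<Longrightarrow> \<X> m \<subseteq> X"
    and "\<And>m. m \<ge> 1 \<Longrightarrow> discrete (\<X> m)"
    and "c > 0" and "C > 0" and "C \<ge> c / 2"
    and "quasi_uniformly_distributed X \<X> c C"
    and "\<alpha> > (real CARD('d) + 2) / 2" and "\<kappa> > 0"
    and "K \<in> kernel_class \<kappa> \<alpha>"
    and "f \<in> BC X"
    and "n \<ge> 1"
  shows "(\<lambda>x. inverse (kernel_sum \<X> C K n x) * kernel_operator \<X> C K n f x - f x) \<in> BC X \<and>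
         bc_norm X (\<lambda>x. inverse (kernel_sum \<X> C K n x) * kernel_operator \<X> C K n f x - f x)
           \<le> \<kappa> * inverse (kernel_min K) * (C + 1) * dim_const CARD('d) c C
               * decay_const \<alpha> CARD('d) * modulus X f (real n powr (- 1 / real CARD('d)))"
proof -
  let ?d = "CARD('d)"
  define h where "h = real n powr (- 1 / real ?d)"
  define b where "b = inverse C * real n powr (1 / real ?d)"
  define P where "P = \<X> n"
  define S where "S = kernel_sum \<X> C K n"
  define T where "T = kernel_operator \<X> C K n f"
  define m where "m = kernel_min K"
  define \<omega> where "\<omega> = modulus X f h"
  define A where "A = (C + 1) * \<kappa> * 2 powr ((real ?d + 1) / 2)"
  define w where "w = (\<lambda>x y :: real ^ 'd. inverse ((1 + b * dist x y) ^ (?d + 1)))"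
  define k where "k = (\<lambda>x y. K (b *\<^sub>R (x - y)))"
  \<comment> \<open>\<open>n \<ge> 1\<close> matters here, since \<open>0 powr _\<close> is
    0.\<close>
  have h: "h > 0" and b: "b > 0" using assms by (auto simp: h_def b_def)
  have inv_h: "real n powr (1 / real ?d) = inverse h"
    unfolding h_def by (simp add: powr_minus flip: minus_divide_left)
  \<comment> \<open>This turns \<open>C * norm (b *\<^sub>R (x - y))\<close> into
    \<open>dist x y / h\<close>, so kernel decay meets the modulus inequality at scale
    \<open>h\<close>.\<close>
  have bh: "C * b = 1 / h" and b_eq: "b = 1 / (C * h)"
    using \<open>C > 0\<close> unfolding b_def inv_h by (auto simp: field_simps)
  define \<delta> where "\<delta> = c * h"
  \<comment> \<open>\<open>b * \<delta>\<close> equals \<open>c / C\<close>, so the second claim is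
    exactly \<open>C \<ge> c / 2\<close>.\<close>
  have \<delta>: "\<delta> > 0" and b\<delta>: "b * \<delta> \<le> 2" and ratio: "2 / (b * \<delta>) = 2 * (C / c)"
    using assms h by (auto simp: \<delta>_def b_eq field_simps)
  have sep: "\<delta> \<le> dist y z" if "y \<in> P" "z \<in> P" "y \<noteq> z" for y z
    using quasi_uniformly_distributed_separated[OF assms(8,13)] that
    unfolding \<delta>_def h_def P_def by blast
  have "P \<subseteq> X" using assms unfolding P_def by blast
  obtain B where B: "\<And>x. x \<in> X \<Longrightarrow> \<bar>f x\<bar> \<le> B"
    using assms(12) unfolding BC_def bounded_iff by auto
  have K_cont: "continuous_on UNIV K" and K_nonneg: "\<And>v. 0 \<le> K v" and m: "m > 0"
    using assms(11) unfolding kernel_class_def m_def by auto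
  have decay: "(1 + C * norm v) * K v \<le> A * inverse ((1 + norm v) ^ (?d + 1))" for v
    unfolding A_def using kernel_class_decay[OF assms(11,10,6,9)] .
  have K_le: "\<bar>K v\<bar> \<le> A * inverse ((1 + norm v) ^ (?d + 1))" for v
  proof -
    have "1 * K v \<le> (1 + C * norm v) * K v"
      using \<open>C > 0\<close> K_nonneg by (intro mult_right_mono) auto
    with decay[of v] K_nonneg[of v] show ?thesis by simp
  qed
  have k_nonneg: "k x y \<ge> 0" for x y by (simp add: k_def K_nonneg)
  have k_decay: "(1 + dist x y / h) * k x y \<le> A * w x y" for x y
    using decay[of "b *\<^sub>R (x - y)"] b bh unfolding k_def w_def
    by (simp add: dist_norm del: power_Suc flip: mult.assoc)
  have k_le: "k x y \<le> A * w x y" for x y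
    using K_le[of "b *\<^sub>R (x - y)"] b unfolding k_def w_def by (simp add: dist_norm del: power_Suc)
  have S_eq: "S = (\<lambda>x. \<Sum>\<^sub>\<infinity>y\<in>P. k x y)" and T_eq: "T = (\<lambda>x. \<Sum>\<^sub>\<infinity>y\<in>P. f y * k x y)"
    unfolding S_def T_def kernel_sum_def kernel_operator_def scaled_kernel_def k_def P_def b_def
    by auto
  have w_sum: "w x summable_on P"
    and w_le: "(\<Sum>\<^sub>\<infinity>y\<in>P. w x y) \<le> 2 ^ (?d + 1) * (2 * (C / c)) ^ ?d" for x
    using summable_on_separated[OF \<delta> b b\<delta> sep, of P x] infsum_separated_le[OF \<delta> b b\<delta> sep, of P x]
    unfolding w_def ratio by auto
  have k_sum: "k x summable_on P" for x
    by (rule summable_on_comparison_test[OF summable_on_cmult_right[OF w_sum[of x], of A]])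
      (auto simp: k_le k_nonneg)
  have fk_sum: "(\<lambda>y. f y * k x y) summable_on P" for x
  proof (rule abs_summable_summable, rule Infinite_Sum.abs_summable_on_comparison_test')
    show "(\<lambda>y. B * k x y) summable_on P" by (intro summable_on_cmult_right k_sum)
    show "norm (f y * k x y) \<le> B * k x y" if "y \<in> P" for y
      using B[of y] that \<open>P \<subseteq> X\<close> k_nonneg[of x y] by (auto simp: abs_mult intro!: mult_right_mono)
  qed
  have S_cont: "continuous_on UNIV S"
    using continuous_on_infsum_separated[OF \<delta> b b\<delta> sep K_cont, of P A "\<lambda>_. 1" 1] K_le
    unfolding S_eq k_def by simp
  have T_cont: "continuous_on UNIV T"
    using continuous_on_infsum_separated[OF \<delta> b b\<delta> sep K_cont, of P A f B] K_le B \<open>P \<subseteq> X\<close>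
    unfolding T_eq k_def by auto
  \<comment> \<open>One covering node suffices: its scaled offset lies in the closed unit ball, and
    all other terms are nonnegative.\<close>
  have S_ge: "m \<le> S x" if x: "x \<in> X" for x
  proof -
    obtain y where y: "y \<in> P" "dist x y \<le> C * h"
      using quasi_uniformly_distributed_covering[OF assms(8,13,5) x] unfolding P_def h_def .
    have "norm (b *\<^sub>R (x - y)) = b * dist x y"
      using b by (simp add: dist_norm)
    also have "\<dots> \<le> 1"
      using y h \<open>C > 0\<close> by (simp add: b_eq)
    finally have "norm (b *\<^sub>R (x - y)) \<le> 1" .
    then have "m \<le> k x y"
      unfolding m_def kernel_min_def k_def
      by (intro cINF_lower bdd_belowI2[of _ 0]) (auto simp: K_nonneg)
    also have "\<dots> = (\<Sum>y\<in>{y}. k x y)" by simp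
    also have "\<dots> \<le> S x"
      unfolding S_eq by (rule finite_sum_le_infsum) (use y k_sum k_nonneg in auto)
    finally show ?thesis .
  qed
  have \<omega>: "\<omega> \<ge> 0"
    using BC_abs_diff_le_modulus[OF assms(12)] assms(2) h unfolding \<omega>_def by force
  have A: "A \<ge> 0" using assms by (simp add: A_def)
  define D where "D = \<kappa> * inverse m * (C + 1) * dim_const ?d c C * decay_const \<alpha> ?d * \<omega>"
  \<comment> \<open>The exponent \<open>(3 * d + 3) / 2\<close> splits into
    \<open>(d + 1) / 2\<close> from the decay bound and \<open>d + 1\<close> from the dyadic sum.
    The leftover \<open>2 ^ d\<close> from \<open>(2 * (C / c)) ^ d\<close> is absorbed by
    \<open>decay_const\<close>.\<close>
  have const: "inverse m * (\<omega> * A * (2 ^ (?d + 1) * (2 * (C / c)) ^ ?d)) \<le> D"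
  proof -
    have "2 powr ((real ?d + 1) / 2) * (2 ^ (?d + 1) * (2 * (C / c)) ^ ?d)
        = dim_const ?d c C * 2 ^ ?d"
    proof -
      have "(2::real) powr ((real ?d + 1) / 2) * 2 ^ (?d + 1) = 2 powr ((real ?d + 1) / 2 + real (?d + 1))"
        unfolding powr_add using powr_realpow[of 2 "?d + 1"] by simp
      also have "(real ?d + 1) / 2 + real (?d + 1) = (3 * real ?d + 3) / 2" by (simp add: field_simps)
      finally have "dim_const ?d c C
          = 2 powr ((real ?d + 1) / 2) * 2 ^ (?d + 1) * (C / c) ^ ?d"
        unfolding dim_const_def by simp
      then show ?thesis
        unfolding power_mult_distrib[of 2] by (simp only: mult_ac)
    qed
    also have "\<dots> \<le> dim_const ?d c C * decay_const \<alpha> ?d"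
      using assms by (intro mult_left_mono decay_const_ge) (auto simp: dim_const_def)
    finally have "(\<kappa> * inverse m * (C + 1) * \<omega>) * (2 powr ((real ?d + 1) / 2) * (2 ^ (?d + 1) * (2 * (C / c)) ^ ?d))
       \<le> (\<kappa> * inverse m * (C + 1) * \<omega>) * (dim_const ?d c C * decay_const \<alpha> ?d)"
      using assms m \<omega> by (intro mult_left_mono) auto
    then show ?thesis unfolding D_def A_def by (simp only: mult_ac)
  qed
  have err: "\<bar>inverse (S x) * T x - f x\<bar> \<le> D" if "x \<in> X" for x
  proof -
    have "S x > 0" using S_ge[OF that] m by simp
    \<comment> \<open>Expanding \<open>f x * S x\<close> over the same nodes gives a single series
      in \<open>f y - f x\<close>, which is then dominated termwise by
      \<open>\<omega> * A * w x y\<close>.\<close>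
    have "((\<lambda>y. f y * k x y + (- f x) * k x y) has_sum (T x + (- f x) * S x)) P"
      unfolding T_eq S_eq
      by (intro has_sum_add has_sum_cmult_right has_sum_infsum fk_sum k_sum)
    then have "((\<lambda>y. (f y - f x) * k x y) has_sum (T x - f x * S x)) P"
      by (simp add: left_diff_distrib)
    then have "norm (T x - f x * S x) \<le> \<omega> * A * (\<Sum>\<^sub>\<infinity>y\<in>P. w x y)"
    proof (rule norm_infsum_le)
      show "((\<lambda>y. \<omega> * A * w x y) has_sum (\<omega> * A * (\<Sum>\<^sub>\<infinity>y\<in>P. w x y))) P"
        by (intro has_sum_cmult_right has_sum_infsum w_sum)
      fix y assume "y \<in> P"
      then have "\<bar>f x - f y\<bar> \<le> (1 + dist x y / h) * \<omega>"
        unfolding \<omega>_def using assms that h \<open>P \<subseteq> X\<close> by (intro abs_diff_le_modulus) auto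
      then have "norm ((f y - f x) * k x y) \<le> (1 + dist x y / h) * \<omega> * k x y"
        by (simp add: abs_mult abs_minus_commute mult_right_mono k_nonneg)
      also have "\<dots> \<le> \<omega> * (A * w x y)"
        using mult_left_mono[OF k_decay[of x y] \<omega>] by (simp add: mult_ac)
      finally show "norm ((f y - f x) * k x y) \<le> \<omega> * A * w x y" by (simp add: mult.assoc)
    qed
    also have "\<dots> \<le> \<omega> * A * (2 ^ (?d + 1) * (2 * (C / c)) ^ ?d)"
      using \<omega> A w_le by (intro mult_left_mono) auto
    finally have "inverse (S x) * \<bar>T x - f x * S x\<bar>
        \<le> inverse m * (\<omega> * A * (2 ^ (?d + 1) * (2 * (C / c)) ^ ?d))"
      using S_ge[OF that] m by (intro mult_mono le_imp_inverse_le) auto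
    moreover have "inverse (S x) * T x - f x = inverse (S x) * (T x - f x * S x)"
      using \<open>S x > 0\<close> by (simp add: field_simps)
    ultimately show ?thesis
      using const \<open>S x > 0\<close> by (simp add: abs_mult)
  qed
  have "continuous_on X (\<lambda>x. inverse (S x) * T x - f x)"
    using S_ge m assms(12) unfolding BC_def
    by (intro continuous_intros continuous_on_subset[OF S_cont] continuous_on_subset[OF T_cont]) force+
  moreover have "bounded ((\<lambda>x. inverse (S x) * T x - f x) ` X)"
    using err by (auto simp: bounded_iff)
  moreover have "bc_norm X (\<lambda>x. inverse (S x) * T x - f x) \<le> D"
    unfolding bc_norm_def
  \<comment> \<open>\<open>D\<close> is one of the bounds by \<open>err\<close>. A point of
    \<open>X\<close> forces every bound to be nonnegative; for empty \<open>X\<close> all reals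
    would qualify and the set would be unbounded below.\<close>
  proof (rule cInf_lower)
    obtain x where "x \<in> X" using assms(2) by blast
    then show "bdd_below {M. \<forall>x\<in>X. \<bar>inverse (S x) * T x - f x\<bar> \<le> M}"
      by (intro bdd_belowI[of _ 0]) (force intro: order_trans[OF abs_ge_zero])
  qed (use err in auto)
  ultimately show ?thesis
    unfolding D_def S_def T_def m_def \<omega>_def h_def BC_def by simp
qed

end
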